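(* Assume that $f$ and $c$ are twice continuously differentiable on an open set $\Omega\supseteq\{x\in\mathbb{R}^n: x\ge 0\}$. Run the stabilized LCL algorithm (described in the context) on (GNP) with tolerances $\omega_*=\eta_*=0$, and suppose it generates infinite sequences; let $\{(x_k,y_k,z_k)\}$ be the sequence of vectors generated. Suppose that all $x_k^*$ lie in a closed and bounded set $B\subset\mathbb{R}^n$, that the sequence $\{x_k^*\}$ has a single limit point $x_*$, and that $\hat J(x_* )$ has full row rank. Set $y_*=\tilde y(x_* )$ and $z_*=\nabla_x\mathcal{L}(x_*,y_*,0)$. Then $$\lim_{k\to\infty}(x_k,y_k,z_k)=(x_*,y_*,z_* ),$$ and $(x_*,y_*,z_* )$ is a first-order KKT point for (GNP).
   Context: The problem is (GNP): minimize $f(x)$ over $x\in\mathbb{R}^n$ subject to $c(x)=0$, $x\ge0$, with $f:\mathbb{R}^n\to\mathbb{R}$ and $c:\mathbb{R}^n\to\mathbb{R}^m$. It is a standing assumption that (GNP) is feasible and has at least one first-order KKT point. $g(x)$ is the gradient of $f$, $J(x)$ the $m\times n$ Jacobian of $c$, $e$ a vector of ones. $\|\cdot\|$ is the Euclidean norm; inequalities and $\min(\cdot,\cdot)$ between vectors are componentwise. The augmented Lagrangian is $\mathcal{L}(x,y,\rho)=f(x)-y^Tc(x)+\tfrac12\rho\|c(x)\|^2$, so $\nabla_x\mathcal{L}(x,y,\rho)=g(x)-J(x)^T(y-\rho c(x))$. A triple $(x,y,z)$ is a first-order KKT point for (GNP) if $c(x)=0$, $\nabla_x\mathcal{L}(x,y,\rho)=z$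 for any $\rho\ge0$, and $\min(x,z)=0$. Given a limit point $x_*$ of $\{x_k^*\}$, let $\mathcal{I}=\{i:[x_*]_i>0\}$. Then $\hat g(x)$ is the subvector of $g(x)$ indexed by $\mathcal{I}$ and $\hat J(x)$ is the submatrix of the columns of $J(x)$ indexed by $\mathcal{I}$. Where $\hat J(x)$ has full row rank, $\tilde y(x)$ is the unique minimizer over $y\in\mathbb{R}^m$ of $\|\hat g(x)-\hat J(x)^Ty\|^2$. Stabilized LCL algorithm. Parameters: $\overline\sigma>\underline\sigma>0$; $\tau_\rho,\tau_\sigma>1$; $\rho_0>1$; $\sigma_0>1$; tolerances $\omega_*,\eta_*\in[0,1)$; $\omega_0>\omega_*$; $\eta_0>\eta_*$; $0<\alpha<1$; $\beta>0$. Input: $x_0\in\Omega$, $y_0\in\mathbb{R}^m$, $z_0\in\mathbb{R}^n$. For $k=0,1,2,\dots$: (i) Choose $\omega_k>0$ with $\omega_k\ge\omega_*$, in such a way that $\lim_{k\to\infty}\omega_k=\omega_*$. (ii) Obtain an approximate solution of the elastic subproblem: minimize $\mathcal{L}(x,y_k,\rho_k)+\sigma_k e^T(v+w)$ over $x,v,w$ subject to $c(x_k)+J(x_k)(x-x_k)+v-w=0$, $x,v,w\ge0$. That is, obtain $(x_k^*,\Delta y_k^*,z_k^* )$ and $v_k^*,w_k^*\in\mathbb{R}^m$ with $x_k^*,v_k^*,w_k^*\ge0$; $c(x_k)+J(x_k)(x_k^*-x_k)+v_k^*-w_k^*=0$; $\nabla_x\mathcal{L}(x_k^*,y_k,\rho_k)-J(x_k)^T\Delta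 y_k^*=z_k^*$; $\|\min(x_k^*,z_k^* )\|_\infty\le\omega_k$; $\|\Delta y_k^*\|_\infty\le\sigma_k+\omega_k$. If there is more than one such point, take the one closest in norm to $(x_k,0,z_k)$. Set $y_k^*=y_k+\Delta y_k^*$. (iii) If $\|c(x_k^* )\|\le\max(\eta_*,\eta_k)$ (successful iteration): set $x_{k+1}=x_k^*$, $y_{k+1}=y_k^*-\rho_kc(x_k^* )$, $z_{k+1}=z_k^*$, $\rho_{k+1}=\rho_k$, $\sigma_{k+1}=\max\{\underline\sigma,\min(\|\Delta y_k^*\|_\infty,\overline\sigma)\}$; stop if $(x,y,z)=(x_{k+1},y_{k+1},z_{k+1})$ satisfies $\|c(x)\|\le\eta_*$, $\nabla_x\mathcal{L}(x,y,\rho)=z$, $\|\min(x,z)\|_\infty\le\omega_*$ (when $\omega_*=\eta_*=0$ this means being a first-order KKT point); set $\eta_{k+1}=\eta_k/\rho_{k+1}^{\beta}$. (iv) Otherwise (unsuccessful iteration): set $x_{k+1}=x_k$, $y_{k+1}=y_k$, $z_{k+1}=z_k$, $\rho_{k+1}=\tau_\rho\rho_k$, $\sigma_{k+1}=\sigma_k/\tau_\sigma$, $\eta_{k+1}=\eta_0/\rho_{k+1}^{\alpha}$. *)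

theory Defs
  imports "HOL-Analysis.Analysis"
begin

section \<open>Smoothness, gradient and componentwise minimum\<close>

definition twice_cont_diff_on ::
  "'a::real_normed_vector set \<Rightarrow> ('a \<Rightarrow> 'b::real_normed_vector) \<Rightarrow> bool" where
  "twice_cont_diff_on S h \<longleftrightarrow>
     (\<exists>(h' :: 'a \<Rightarrow> 'a \<Rightarrow>\<^sub>L 'b) (h'' :: 'a \<Rightarrow> 'a \<Rightarrow>\<^sub>L ('a \<Rightarrow>\<^sub>L 'b)).
        (\<forall>x\<in>S. (h has_derivative blinfun_apply (h' x)) (at x)) \<and>
        (\<forall>x\<in>S. (h' has_derivative blinfun_apply (h'' x)) (at x)) \<and>
        continuous_on S h'')"

text \<open>Meaningful only where the function is differentiable, in which case the gradient is unique.\<close>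
definition grad :: "('a::real_inner \<Rightarrow> real) \<Rightarrow> 'a \<Rightarrow> 'a" where
  "grad h x = (THE D. GDERIV h x :> D)"

lemma grad_eqI: "GDERIV h x :> D \<Longrightarrow> grad h x = D"
  unfolding grad_def
proof (rule the_equality)
  fix D' assume "GDERIV h x :> D" "GDERIV h x :> D'"
  then have "(\<lambda>u. inner u D) = (\<lambda>u. inner u D')"
    unfolding gderiv_def by (rule has_derivative_unique)
  then have "inner (D' - D) D = inner (D' - D) D'"
    by meson
  then show "D' = D"
    by (metis inner_diff_right inner_eq_zero_iff eq_iff_diff_eq_0)
qed

definition vmin :: "real^'n \<Rightarrow> real^'n \<Rightarrow> real^'n" where
  "vmin x z = (\<chi> i. min (x $ i) (z $ i))"

section \<open>The problem: minimize f x subject to c x = 0 and 0 \<le> x\<close>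

abbreviation Jac :: "(real^'n \<Rightarrow> real^'m) \<Rightarrow> real^'n \<Rightarrow> real^'n^'m" where
  "Jac c x \<equiv> jacobian c (at x)"

definition aug_lagrangian ::
  "(real^'n \<Rightarrow> real) \<Rightarrow> (real^'n \<Rightarrow> real^'m) \<Rightarrow> real^'n \<Rightarrow> real^'m \<Rightarrow> real \<Rightarrow> real" where
  "aug_lagrangian f c x y \<rho> = f x - y \<bullet> c x + 1/2 * \<rho> * (norm (c x))\<^sup>2"

definition grad_aug_lagrangian ::
  "(real^'n \<Rightarrow> real) \<Rightarrow> (real^'n \<Rightarrow> real^'m) \<Rightarrow> real^'n \<Rightarrow> real^'m \<Rightarrow> real \<Rightarrow> real^'n" where
  "grad_aug_lagrangian f c x y \<rho> = grad (\<lambda>u. aug_lagrangian f c u y \<rho>) x"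

lemma grad_aug_lagrangian_eq:
  fixes c :: "real^'n \<Rightarrow> real^'m"
  assumes f: "f differentiable (at x)" and c: "c differentiable (at x)"
  shows "grad_aug_lagrangian f c x y \<rho> = grad f x - transpose (Jac c x) *v (y - \<rho> *\<^sub>R c x)"
proof -
  obtain f' where f': "(f has_derivative f') (at x)"
    using f by (auto simp: differentiable_def)
  have "f' = (\<lambda>h. h \<bullet> adjoint f' 1)"
    using adjoint_works[OF has_derivative_linear[OF f'], of _ 1] by (auto simp: fun_eq_iff)
  then have D: "GDERIV f x :> grad f x"
    using f' grad_eqI[of f x "adjoint f' 1"] unfolding gderiv_def by metis
  have C: "(c has_derivative (\<lambda>h. Jac c x *v h)) (at x)"
    using c jacobian_works by blast
  have "GDERIV (\<lambda>u. aug_lagrangian f c u y \<rho>) x :>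
      grad f x - transpose (Jac c x) *v (y - \<rho> *\<^sub>R c x)"
    unfolding gderiv_def aug_lagrangian_def power2_norm_eq_inner
    by (rule derivative_eq_intros D[unfolded gderiv_def] C refl)+
       (auto simp: fun_eq_iff inner_diff_right inner_commute algebra_simps
         dot_lmul_matrix[symmetric] matrix_vector_mult_diff_distrib matrix_vector_mult_scaleR)
  then show ?thesis
    unfolding grad_aug_lagrangian_def by (rule grad_eqI)
qed

definition feasible :: "(real^'n \<Rightarrow> real^'m) \<Rightarrow> real^'n \<Rightarrow> bool" where
  "feasible c x \<longleftrightarrow> c x = 0 \<and> 0 \<le> x"

definition KKT_point ::
  "(real^'n \<Rightarrow> real) \<Rightarrow> (real^'n \<Rightarrow> real^'m) \<Rightarrow> real^'n \<Rightarrow> real^'m \<Rightarrow> real^'n \<Rightarrow> bool" where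
  "KKT_point f c x y z \<longleftrightarrow>
     c x = 0 \<and> (\<forall>\<rho>\<ge>0. grad_aug_lagrangian f c x y \<rho> = z) \<and> vmin x z = 0"

section \<open>Least-squares multiplier estimate\<close>

text \<open>
  The subvector and the submatrix of columns indexed by a set I are represented with the
  entries outside I replaced by 0. This changes neither the rank nor the least-squares
  residual; see the two lemmas below.
\<close>

definition restrict_vec :: "'n set \<Rightarrow> real^'n \<Rightarrow> real^'n" where
  "restrict_vec I g = (\<chi> j. if j \<in> I then g $ j else 0)"

definition restrict_cols :: "'n set \<Rightarrow> real^'n^'m \<Rightarrow> real^'n^'m" where
  "restrict_cols I A = (\<chi> i j. if j \<in> I then A $ i $ j else 0)"

lemma rank_restrict_cols:
  fixes A :: "real^'n^'m"
  shows "rank (restrict_cols I A) = dim {column j A | j. j \<in> I}"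
proof -
  have eq: "column j (restrict_cols I A) = (if j \<in> I then column j A else 0)" for j
    by (simp add: column_def restrict_cols_def vec_eq_iff)
  have "columns (restrict_cols I A) - {0} = {column j A | j. j \<in> I} - {0}"
    by (auto simp: columns_def eq)
  then have "span (columns (restrict_cols I A)) = span {column j A | j. j \<in> I}"
    using span_delete_0 [of "columns (restrict_cols I A)"]
      span_delete_0 [of "{column j A | j. j \<in> I}"] by simp
  then have "dim (columns (restrict_cols I A)) = dim {column j A | j. j \<in> I}"
    by (rule span_eq_dim)
  then show ?thesis
    by (simp only: column_rank_def)
qed

lemma norm_restrict_residual:
  fixes A :: "real^'n^'m"
  shows "(norm (restrict_vec I g - transpose (restrict_cols I A) *v y))\<^sup>2
           = (\<Sum>j\<in>I. (g $ j - column j A \<bullet> y)\<^sup>2)"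
proof -
  have "(restrict_vec I g - transpose (restrict_cols I A) *v y) $ j
          = (if j \<in> I then g $ j - column j A \<bullet> y else 0)" for j
    by (simp add: restrict_vec_def restrict_cols_def transpose_def matrix_vector_mult_def
        column_def inner_vec_def)
  then have "(norm (restrict_vec I g - transpose (restrict_cols I A) *v y))\<^sup>2
          = (\<Sum>j\<in>UNIV. if j \<in> I then (g $ j - column j A \<bullet> y)\<^sup>2 else 0)"
    unfolding power2_norm_eq_inner inner_vec_def
    by (intro sum.cong) (auto simp: power2_eq_square)
  also have "\<dots> = (\<Sum>j\<in>I. (g $ j - column j A \<bullet> y)\<^sup>2)"
    by (subst sum.inter_restrict [symmetric]) auto
  finally show ?thesis .
qed

definition inactive :: "real^'n \<Rightarrow> 'n set" where
  "inactive xstar = {i. xstar $ i > 0}"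

definition full_row_rank :: "real^'n^'m \<Rightarrow> bool" where
  "full_row_rank (A :: real^'n^'m) \<longleftrightarrow> rank A = CARD('m)"

text \<open>Meaningful only where the restricted Jacobian has full row rank (unique minimizer).\<close>
definition ls_multiplier ::
  "(real^'n \<Rightarrow> real) \<Rightarrow> (real^'n \<Rightarrow> real^'m) \<Rightarrow> 'n set \<Rightarrow> real^'n \<Rightarrow> real^'m" where
  "ls_multiplier f c I x =
     (THE y. is_arg_min
        (\<lambda>y. (norm (restrict_vec I (grad f x) - transpose (restrict_cols I (Jac c x)) *v y))\<^sup>2)
        (\<lambda>_. True) y)"

section \<open>The stabilized LCL algorithm\<close>

record lcl_params =
  sigma_low :: real
  sigma_high :: real
  tau_rho :: real
  tau_sigma :: real
  rho_init :: real
  sigma_init :: real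
  omega_star :: real
  eta_star :: real
  omega_init :: real
  eta_init :: real
  alpha :: real
  beta :: real

definition valid_params :: "lcl_params \<Rightarrow> bool" where
  "valid_params P \<longleftrightarrow>
     0 < sigma_low P \<and> sigma_low P < sigma_high P \<and>
     1 < tau_rho P \<and> 1 < tau_sigma P \<and>
     1 < rho_init P \<and> 1 < sigma_init P \<and>
     0 \<le> omega_star P \<and> omega_star P < 1 \<and>
     0 \<le> eta_star P \<and> eta_star P < 1 \<and>
     omega_star P < omega_init P \<and> eta_star P < eta_init P \<and>
     0 < alpha P \<and> alpha P < 1 \<and> 0 < beta P"

text \<open>
  (xs, dy, zs) is an approximate solution, with tolerance \<open>\<omega>\<close>, of the elastic subproblem
  linearized at xk, with multiplier estimate yk, penalty parameter \<open>\<rho>\<close> and elastic weight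
  \<open>\<sigma>\<close>.
\<close>
definition elastic_solution ::
  "(real^'n \<Rightarrow> real) \<Rightarrow> (real^'n \<Rightarrow> real^'m) \<Rightarrow> real \<Rightarrow> real \<Rightarrow> real \<Rightarrow> real^'n \<Rightarrow> real^'m
     \<Rightarrow> real^'n \<Rightarrow> real^'m \<Rightarrow> real^'n \<Rightarrow> bool" where
  "elastic_solution f c \<omega> \<rho> \<sigma> xk yk xs dy zs \<longleftrightarrow>
     (\<exists>v w. 0 \<le> xs \<and> 0 \<le> v \<and> 0 \<le> w \<and>
            c xk + Jac c xk *v (xs - xk) + v - w = 0) \<and>
     grad_aug_lagrangian f c xs yk \<rho> - transpose (Jac c xk) *v dy = zs \<and>
     infnorm (vmin xs zs) \<le> \<omega> \<and>
     infnorm dy \<le> \<sigma> + \<omega>"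

text \<open>The distance is the one of the product type, i.e. the Euclidean distance of triples.\<close>
definition closest_elastic_solution ::
  "(real^'n \<Rightarrow> real) \<Rightarrow> (real^'n \<Rightarrow> real^'m) \<Rightarrow> real \<Rightarrow> real \<Rightarrow> real \<Rightarrow> real^'n \<Rightarrow> real^'m \<Rightarrow> real^'n
     \<Rightarrow> real^'n \<Rightarrow> real^'m \<Rightarrow> real^'n \<Rightarrow> bool" where
  "closest_elastic_solution f c \<omega> \<rho> \<sigma> xk yk zk xs dy zs \<longleftrightarrow>
     elastic_solution f c \<omega> \<rho> \<sigma> xk yk xs dy zs \<and>
     (\<forall>xs' dy' zs'. elastic_solution f c \<omega> \<rho> \<sigma> xk yk xs' dy' zs' \<longrightarrow>
        dist (xs, dy, zs) (xk, 0, zk) \<le> dist (xs', dy', zs') (xk, 0, zk))"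

definition stopping_test ::
  "(real^'n \<Rightarrow> real) \<Rightarrow> (real^'n \<Rightarrow> real^'m) \<Rightarrow> lcl_params \<Rightarrow> real^'n \<Rightarrow> real^'m \<Rightarrow> real^'n \<Rightarrow> bool"
  where
  "stopping_test f c P x y z \<longleftrightarrow>
     norm (c x) \<le> eta_star P \<and>
     (\<forall>\<rho>\<ge>0. grad_aug_lagrangian f c x y \<rho> = z) \<and>
     infnorm (vmin x z) \<le> omega_star P"

text \<open>
  The sequences form an infinite run, i.e. the stopping test fails after every successful
  iteration. The sequences xs, dy, zs are the subproblem solutions; x, y, z are the iterates.
\<close>
definition stabilized_LCL_run ::
  "(real^'n \<Rightarrow> real) \<Rightarrow> (real^'n \<Rightarrow> real^'m) \<Rightarrow> (real^'n) set \<Rightarrow> lcl_params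
     \<Rightarrow> (nat \<Rightarrow> real^'n) \<Rightarrow> (nat \<Rightarrow> real^'m) \<Rightarrow> (nat \<Rightarrow> real^'n)
     \<Rightarrow> (nat \<Rightarrow> real) \<Rightarrow> (nat \<Rightarrow> real) \<Rightarrow> (nat \<Rightarrow> real) \<Rightarrow> (nat \<Rightarrow> real)
     \<Rightarrow> (nat \<Rightarrow> real^'n) \<Rightarrow> (nat \<Rightarrow> real^'m) \<Rightarrow> (nat \<Rightarrow> real^'n) \<Rightarrow> bool" where
  "stabilized_LCL_run f c \<Omega> P x y z \<rho> \<sigma> \<omega> \<eta> xs dy zs \<longleftrightarrow>
     valid_params P \<and>
     x 0 \<in> \<Omega> \<and>
     \<rho> 0 = rho_init P \<and> \<sigma> 0 = sigma_init P \<and> \<omega> 0 = omega_init P \<and> \<eta> 0 = eta_init P \<and>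
     (\<forall>k. 0 < \<omega> k \<and> omega_star P \<le> \<omega> k) \<and> \<omega> \<longlonglongrightarrow> omega_star P \<and>
     (\<forall>k. closest_elastic_solution f c (\<omega> k) (\<rho> k) (\<sigma> k) (x k) (y k) (z k) (xs k) (dy k) (zs k)) \<and>
     (\<forall>k. if norm (c (xs k)) \<le> max (eta_star P) (\<eta> k)
          then x (Suc k) = xs k \<and>
               y (Suc k) = (y k + dy k) - \<rho> k *\<^sub>R c (xs k) \<and>
               z (Suc k) = zs k \<and>
               \<rho> (Suc k) = \<rho> k \<and>
               \<sigma> (Suc k) = max (sigma_low P) (min (infnorm (dy k)) (sigma_high P)) \<and>
               \<not> stopping_test f c P (x (Suc k)) (y (Suc k)) (z (Suc k)) \<and>
               \<eta> (Suc k) = \<eta> k / \<rho> (Suc k) powr beta P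
          else x (Suc k) = x k \<and>
               y (Suc k) = y k \<and>
               z (Suc k) = z k \<and>
               \<rho> (Suc k) = tau_rho P * \<rho> k \<and>
               \<sigma> (Suc k) = \<sigma> k / tau_sigma P \<and>
               \<eta> (Suc k) = eta_init P / \<rho> (Suc k) powr alpha P)"

definition limit_points :: "(nat \<Rightarrow> 'a::topological_space) \<Rightarrow> 'a set" where
  "limit_points s = {l. \<exists>r. strict_mono r \<and> (s \<circ> r) \<longlonglongrightarrow> l}"

end

theory Submission
  imports Defs
begin

text \<open>
  Boundedness and uniqueness of the limit point make \<open>xs\<close> converge to \<open>xstar\<close>. The proof
  follows the trial multipliers \<open>u k = y k + dy k - \<rho> k *\<^sub>R c (xs k)\<close>, which become the next
  multiplier estimate when iteration \<open>k\<close> succeeds. Stationarity of the subproblem reads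
  \<open>zs k = grad f (xs k) - u k v* Jac c (xs k) + dy k v* (Jac c (xs k) - Jac c (x k))\<close>.
  Suppose the last term, the linearization error, tends to 0. Approximate complementarity
  drives the inactive components of \<open>zs\<close> to 0, so in those components
  \<open>u k v* Jac c (xs k)\<close> converges to \<open>grad f xstar\<close>; full row rank then forces \<open>u\<close> to converge,
  and its limit solves the least-squares problem with zero residual. Hence
  \<open>u \<longlonglongrightarrow> ystar\<close> (lemma \<open>trial_y_lim\<close>).

  It remains to see why the linearization error vanishes, and this is where successes matter.
  \<^item> There are infinitely many of them. If there were only finitely many, \<open>x\<close> and \<open>y\<close> would
    eventually be constant and \<open>\<sigma>\<close>, hence \<open>dy\<close>, would tend to 0. The error
    would vanish, \<open>u\<close> would converge, and \<open>\<rho> k *\<^sub>R c (xs k) = y k + dy k - u k\<close> would be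
    bounded. So \<open>c (xs k)\<close> would be of order \<open>1 / \<rho> k\<close>, below the threshold of order
    \<open>1 / \<rho> k powr alpha\<close> because \<open>alpha < 1\<close> and \<open>\<rho>\<close> is unbounded: a success after all.
  \<^item> With infinitely many successes, \<open>x k\<close> repeats the last accepted entry of \<open>xs\<close> and so also
    tends to \<open>xstar\<close>. The difference of Jacobians vanishes and \<open>dy\<close> is bounded, so the error
    vanishes. Then \<open>u \<longlonglongrightarrow> ystar\<close>, and \<open>y\<close>, \<open>z\<close> inherit the limits of \<open>u\<close>, \<open>zs\<close> in the same way.

  For the KKT conditions, complementarity and stationarity pass to the limit. Feasibility
  holds because either \<open>\<eta>\<close> decays geometrically along an eventually successful run, or \<open>\<rho>\<close> is
  unbounded while \<open>\<rho> k *\<^sub>R c (xs k)\<close> stays bounded.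
\<close>

section \<open>Real and metric sequences\<close>

lemma bounded_limit_points_singleton_imp_tendsto:
  fixes s :: "nat \<Rightarrow> 'a::heine_borel"
  assumes "bounded (range s)" and "limit_points s = {l}"
  shows "s \<longlonglongrightarrow> l"
proof (rule ccontr)
  assume "\<not> s \<longlonglongrightarrow> l"
  then obtain e where "e > 0" and far: "\<And>N. \<exists>n\<ge>N. e \<le> dist (s n) l"
    unfolding lim_sequentially by (meson not_less)
  then have "infinite {n. e \<le> dist (s n) l}"
    unfolding infinite_nat_iff_unbounded_le by blast
  then obtain r :: "nat \<Rightarrow> nat" where r: "strict_mono r" "\<And>n. r n \<in> {n. e \<le> dist (s n) l}"
    using infinite_enumerate by blast
  have "bounded (range (s \<circ> r))"
    using assms(1) by (rule bounded_subset) auto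
  then obtain l' q where q: "strict_mono q" "((s \<circ> r) \<circ> q) \<longlonglongrightarrow> l'"
    using bounded_imp_convergent_subsequence by blast
  have "strict_mono (r \<circ> q)" "(s \<circ> (r \<circ> q)) \<longlonglongrightarrow> l'"
    using strict_mono_o [OF r(1) q(1)] q(2) by (simp_all only: comp_assoc)
  then have "l' \<in> limit_points s"
    unfolding limit_points_def by blast
  then have "((s \<circ> r) \<circ> q) \<longlonglongrightarrow> l"
    using assms(2) q(2) by simp
  then have "\<forall>\<^sub>F n in sequentially. dist (s (r (q n))) l < e"
    using \<open>e > 0\<close> by (auto simp: tendsto_iff)
  then obtain n where "dist (s (r (q n))) l < e"
    by (auto simp: eventually_sequentially)
  then show False
    using r(2) [of "q n"] by simp
qed

text \<open>
  The sequence \<open>s\<close> records the most recent accepted entry of \<open>t\<close>; the iterates of the algorithm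
  are related to the subproblem solutions in this way.
\<close>
lemma tendsto_last_accepted:
  fixes s t :: "nat \<Rightarrow> 'a::metric_space"
  assumes "t \<longlonglongrightarrow> l" and "infinite {k. A k}"
    and s: "\<And>k. s (Suc k) = (if A k then t k else s k)"
  shows "s \<longlonglongrightarrow> l"
proof (rule metric_LIMSEQ_I)
  fix e :: real
  assume "0 < e"
  then obtain N where N: "\<And>k. k \<ge> N \<Longrightarrow> dist (t k) l < e"
    using metric_LIMSEQ_D [OF assms(1)] by blast
  obtain m where m: "m \<ge> N" "A m"
    using assms(2) by (auto simp: infinite_nat_iff_unbounded_le)
  have "dist (s k) l < e" if "k \<ge> Suc m" for k
    using that
  proof (induction k rule: dec_induct)
    case base
    then show ?case using m N s by simp
  next
    case (step k)
    then show ?case using m N [of k] s [of k] by auto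
  qed
  then show "\<exists>no. \<forall>k\<ge>no. dist (s k) l < e"
    by blast
qed

lemma filterlim_at_top_if_scaled_infinitely_often:
  fixes r :: "nat \<Rightarrow> real"
  assumes "1 < \<tau>" and "1 \<le> r 0" and "infinite {k. \<not> A k}"
    and r: "\<And>k. r (Suc k) = (if A k then r k else \<tau> * r k)"
  shows "filterlim r at_top sequentially"
proof -
  have ge1: "1 \<le> r k" for k
    by (induction k) (use assms(1,2) r mult_mono [of 1 \<tau> 1] in auto)
  have step: "r k \<le> r (Suc k)" for k
    using assms(1) ge1 [of k] mult_right_mono [of 1 \<tau> "r k"] by (auto simp: r)
  have mono: "r m \<le> r k" if "m \<le> k" for m k
    using lift_Suc_mono_le [of r, OF step that] .
  have pow: "\<exists>m. \<tau> ^ n \<le> r m" for n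
  proof (induction n)
    case 0
    then show ?case using ge1 by auto
  next
    case (Suc n)
    then obtain m where m: "\<tau> ^ n \<le> r m" by blast
    obtain k where k: "k \<ge> m" "\<not> A k"
      using assms(3) by (auto simp: infinite_nat_iff_unbounded_le)
    have "\<tau> ^ Suc n \<le> \<tau> * r k"
      using m mono [OF k(1)] assms(1) by simp
    then show ?case using r [of k] k(2) by (intro exI [of _ "Suc k"]) simp
  qed
  show ?thesis
    unfolding filterlim_at_top
  proof
    fix Z :: real
    obtain n where "Z < \<tau> ^ n"
      using real_arch_pow [OF assms(1)] by blast
    moreover obtain m where "\<tau> ^ n \<le> r m"
      using pow by blast
    ultimately have "Z \<le> r k" if "m \<le> k" for k
      using mono [OF that] by linarith
    then show "\<forall>\<^sub>F k in sequentially. Z \<le> r k"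
      unfolding eventually_sequentially by blast
  qed
qed

lemma tendsto_const_mult_power_shift:
  fixes s :: "nat \<Rightarrow> real"
  assumes "0 \<le> q" and "q < 1" and "\<And>k. k \<ge> N \<Longrightarrow> s (Suc k) = q * s k"
  shows "s \<longlonglongrightarrow> 0"
proof -
  have "s (k + N) = q ^ k * s N" for k
    by (induction k) (use assms(3) in auto)
  moreover have "(\<lambda>k. q ^ k * s N) \<longlonglongrightarrow> 0"
    using assms(1,2) by (intro tendsto_mult_left_zero LIMSEQ_realpow_zero)
  ultimately have "(\<lambda>k. s (k + N)) \<longlonglongrightarrow> 0"
    by simp
  then show ?thesis
    by (rule LIMSEQ_offset)
qed

lemma tendsto_zero_if_infnorm_le:
  fixes s :: "nat \<Rightarrow> 'a::euclidean_space"
  assumes "r \<longlonglongrightarrow> 0" and "\<And>k. infnorm (s k) \<le> r k"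
  shows "s \<longlonglongrightarrow> 0"
proof (rule Lim_null_comparison)
  show "\<forall>\<^sub>F k in sequentially. norm (s k) \<le> sqrt (real DIM('a)) * r k"
  proof (intro always_eventually allI)
    fix k
    have "norm (s k) \<le> sqrt (real DIM('a)) * infnorm (s k)"
      by (rule norm_le_infnorm)
    also have "\<dots> \<le> sqrt (real DIM('a)) * r k"
      using assms(2) by (intro mult_left_mono) auto
    finally show "norm (s k) \<le> sqrt (real DIM('a)) * r k" .
  qed
  show "(\<lambda>k. sqrt (real DIM('a)) * r k) \<longlonglongrightarrow> 0"
    using assms(1) by (rule tendsto_mult_right_zero)
qed

section \<open>Linear systems of full row rank and least-squares multipliers\<close>

lemma bounded_bilinear_vector_matrix_mult:
  "bounded_bilinear (\<lambda>(u::real^'m) (A::real^'n^'m). u v* A)"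
  unfolding bilinear_conv_bounded_bilinear [symmetric] bilinear_def
  by (auto intro!: linearI simp: vector_matrix_mult_def vec_eq_iff algebra_simps sum.distrib
      sum_distrib_left)

lemma bounded_bilinear_matrix_vector_mult:
  "bounded_bilinear (\<lambda>(A::real^'n^'m) x. A *v x)"
  unfolding bilinear_conv_bounded_bilinear [symmetric] bilinear_def
  by (auto intro!: linearI simp: matrix_vector_mult_def vec_eq_iff algebra_simps sum.distrib
      sum_distrib_left)

text \<open>
  If \<open>L\<close> has full row rank, \<open>w \<mapsto> w v* L\<close> has a left inverse \<open>R\<close>. Applying \<open>R\<close> to
  \<open>u k v* A k = u k v* L + u k v* (A k - L)\<close> recovers \<open>u k\<close> up to an error of at most half its
  norm for large \<open>k\<close>. This bounds \<open>u\<close>, so the error actually tends to 0 and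
  \<open>u\<close> converges together with \<open>u k v* L\<close>.
\<close>
lemma tendsto_solution_full_row_rank:
  fixes A :: "nat \<Rightarrow> real^'n^'m" and L :: "real^'n^'m"
  assumes rank: "full_row_rank L" and A: "A \<longlonglongrightarrow> L"
    and h: "(\<lambda>k. u k v* A k) \<longlonglongrightarrow> h"
  obtains y where "y v* L = h" and "u \<longlonglongrightarrow> y"
proof -
  interpret vm: bounded_bilinear "\<lambda>(u::real^'m) (A::real^'n^'m). u v* A"
    by (rule bounded_bilinear_vector_matrix_mult)
  interpret mv: bounded_bilinear "\<lambda>(A::real^'m^'n) x. A *v x"
    by (rule bounded_bilinear_matrix_vector_mult)
  interpret mv': bounded_bilinear "\<lambda>(A::real^'n^'m) x. A *v x"
    by (rule bounded_bilinear_matrix_vector_mult)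
  have "inj ((*v) (transpose L))"
    using rank unfolding full_row_rank_def by (metis full_rank_injective rank_transpose)
  then obtain R :: "real^'n^'m" where R: "R ** transpose L = mat 1"
    using matrix_left_invertible_injective by blast
  have RL: "R *v (w v* L) = w" for w
    using arg_cong [OF R, of "\<lambda>M. M *v w"] by (simp flip: matrix_vector_mul_assoc)
  obtain K\<^sub>1 where K1: "K\<^sub>1 > 0" "\<And>w. norm (R *v w) \<le> norm w * K\<^sub>1"
    using bounded_linear.pos_bounded [OF mv'.bounded_linear_right [of R]] by blast
  obtain K\<^sub>2 where K2: "K\<^sub>2 > 0" "\<And>(w::real^'m) A. norm (w v* A :: real^'n) \<le> norm w * norm A * K\<^sub>2"
    using vm.pos_bounded by blast
  have diff: "u k v* (A k - L) = u k v* A k - u k v* L" for k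
    by (rule vm.diff_right)
  have Rh: "(\<lambda>k. R *v (u k v* A k)) \<longlonglongrightarrow> R *v h"
    using h by (rule mv'.tendsto [OF tendsto_const])
  have "(\<lambda>k. norm (A k - L) * K\<^sub>2 * K\<^sub>1) \<longlonglongrightarrow> 0"
    using A by (intro tendsto_mult_left_zero tendsto_norm_zero) (simp add: LIM_zero)
  then have "\<forall>\<^sub>F k in sequentially. norm (A k - L) * K\<^sub>2 * K\<^sub>1 < 1 / 2"
    by (rule order_tendstoD) simp
  then have bound: "\<forall>\<^sub>F k in sequentially. norm (u k) \<le> 2 * norm (R *v (u k v* A k))"
  proof eventually_elim
    case (elim k)
    have "u k = R *v (u k v* A k) - R *v (u k v* (A k - L))"
      by (simp add: diff mv'.diff_right RL)
    then have "norm (u k) \<le> norm (R *v (u k v* A k)) + norm (R *v (u k v* (A k - L)))"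
      by (metis norm_triangle_ineq4)
    also have "norm (R *v (u k v* (A k - L))) \<le> norm (u k v* (A k - L)) * K\<^sub>1"
      by (rule K1(2))
    also have "\<dots> \<le> norm (u k) * norm (A k - L) * K\<^sub>2 * K\<^sub>1"
      using K1(1) K2(2) by (intro mult_right_mono) auto
    also have "\<dots> = norm (u k) * (norm (A k - L) * K\<^sub>2 * K\<^sub>1)"
      by (simp only: mult.assoc)
    also have "\<dots> \<le> norm (u k) * (1 / 2)"
      using elim by (intro mult_left_mono) auto
    finally show ?case
      by simp
  qed
  obtain M where M: "\<And>k. norm (R *v (u k v* A k)) \<le> M"
    using convergent_imp_Bseq [OF convergentI [OF Rh]] by (meson BseqE)
  have "\<forall>\<^sub>F k in sequentially. norm (u k) \<le> 2 * M"
    using bound by eventually_elim (meson M mult_left_mono order_trans zero_le_numeral)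
  then have "Bfun u sequentially"
    by (rule BfunI)
  then have "Zfun (\<lambda>k. u k v* (A k - L)) sequentially"
    using A by (intro vm.Bfun_prod_Zfun) (simp_all add: tendsto_Zfun_iff)
  then have "(\<lambda>k. u k v* A k - u k v* (A k - L)) \<longlonglongrightarrow> h - 0"
    by (intro tendsto_diff h) (simp add: tendsto_Zfun_iff)
  then have uL: "(\<lambda>k. u k v* L) \<longlonglongrightarrow> h"
    by (simp add: diff)
  then have "(\<lambda>k. R *v (u k v* L)) \<longlonglongrightarrow> R *v h"
    by (rule mv'.tendsto [OF tendsto_const])
  then have u: "u \<longlonglongrightarrow> R *v h"
    by (simp add: RL)
  then have "(\<lambda>k. u k v* L) \<longlonglongrightarrow> (R *v h) v* L"
    by (rule vm.tendsto [OF _ tendsto_const])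
  with uL have "(R *v h) v* L = h"
    using LIMSEQ_unique by blast
  with u show ?thesis
    using that by blast
qed

lemma vector_matrix_mult_restrict_cols:
  "u v* restrict_cols I A = restrict_vec I (u v* A)"
  by (simp add: vec_eq_iff restrict_cols_def restrict_vec_def vector_matrix_mult_def)

text \<open>
  An exact solution has residual 0, so any other minimizer is an exact solution as well, and
  full row rank leaves only one.
\<close>
lemma ls_multiplier_eqI:
  fixes c :: "real^'n \<Rightarrow> real^'m"
  assumes rank: "full_row_rank (restrict_cols I (Jac c x))"
    and y: "y v* restrict_cols I (Jac c x) = restrict_vec I (grad f x)"
  shows "ls_multiplier f c I x = y"
proof -
  let ?A = "restrict_cols I (Jac c x)"
  have "inj ((*v) (transpose ?A))"
    using rank unfolding full_row_rank_def by (metis full_rank_injective rank_transpose)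
  then have inj: "y' v* ?A = y v* ?A \<Longrightarrow> y' = y" for y'
    by (simp add: inj_def)
  show ?thesis
    unfolding ls_multiplier_def transpose_matrix_vector
  proof (rule the_equality)
    show "is_arg_min (\<lambda>y. (norm (restrict_vec I (grad f x) - y v* ?A))\<^sup>2) (\<lambda>_. True) y"
      by (simp add: is_arg_min_linorder y)
  next
    fix y'
    assume "is_arg_min (\<lambda>y. (norm (restrict_vec I (grad f x) - y v* ?A))\<^sup>2) (\<lambda>_. True) y'"
    then have "(norm (restrict_vec I (grad f x) - y' v* ?A))\<^sup>2
        \<le> (norm (restrict_vec I (grad f x) - y v* ?A))\<^sup>2"
      by (simp add: is_arg_min_linorder)
    then have "y' v* ?A = y v* ?A"
      by (simp add: y)
    then show "y' = y"
      by (rule inj)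
  qed
qed

section \<open>Continuity of gradient and Jacobian\<close>

lemma twice_cont_diff_on_blinfun:
  fixes h :: "'a::real_normed_vector \<Rightarrow> 'b::real_normed_vector"
  assumes "twice_cont_diff_on S h"
  obtains h' :: "'a \<Rightarrow> 'a \<Rightarrow>\<^sub>L 'b"
  where "\<And>x. x \<in> S \<Longrightarrow> (h has_derivative blinfun_apply (h' x)) (at x)"
    and "\<And>x. x \<in> S \<Longrightarrow> isCont h' x"
proof -
  obtain h' :: "'a \<Rightarrow> 'a \<Rightarrow>\<^sub>L 'b" and h'' :: "'a \<Rightarrow> 'a \<Rightarrow>\<^sub>L ('a \<Rightarrow>\<^sub>L 'b)"
    where h': "\<forall>x\<in>S. (h has_derivative blinfun_apply (h' x)) (at x)"
      and h'': "\<forall>x\<in>S. (h' has_derivative blinfun_apply (h'' x)) (at x)"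
    using assms unfolding twice_cont_diff_on_def by auto
  show ?thesis
  proof (rule that)
    show "(h has_derivative blinfun_apply (h' x)) (at x)" if "x \<in> S" for x
      using h' that by (rule bspec)
    show "isCont h' x" if "x \<in> S" for x
      using h'' that by (intro has_derivative_continuous) (rule bspec)
  qed
qed

lemma twice_cont_diff_on_imp_differentiable:
  "twice_cont_diff_on S h \<Longrightarrow> x \<in> S \<Longrightarrow> h differentiable (at x)"
  by (elim twice_cont_diff_on_blinfun) (auto simp: differentiable_def)

lemma continuous_on_Jac:
  fixes c :: "real^'n \<Rightarrow> real^'m"
  assumes "twice_cont_diff_on S c"
  shows "continuous_on S (Jac c)"
proof -
  obtain c' where c': "\<And>x. x \<in> S \<Longrightarrow> (c has_derivative blinfun_apply (c' x)) (at x)"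
    and cont: "\<And>x. x \<in> S \<Longrightarrow> isCont c' x"
    using twice_cont_diff_on_blinfun [OF assms] by blast
  have "frechet_derivative c (at x) = blinfun_apply (c' x)" if "x \<in> S" for x
    using frechet_derivative_at [OF c' [OF that]] by simp
  then have "Jac c x = (\<chi> i j. blinfun_apply (c' x) (axis j 1) $ i)" if "x \<in> S" for x
    using that by (simp add: jacobian_def matrix_def)
  moreover have "continuous_on S (\<lambda>x. \<chi> i j. blinfun_apply (c' x) (axis j 1) $ i)"
    using cont
    by (intro continuous_on_vec_lambda continuous_on_component continuous_intros)
       (auto intro: continuous_at_imp_continuous_on)
  ultimately show ?thesis
    by simp
qed

lemma continuous_on_grad:
  fixes f :: "real^'n \<Rightarrow> real"
  assumes "twice_cont_diff_on S f"
  shows "continuous_on S (grad f)"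
proof -
  obtain f' where f': "\<And>x. x \<in> S \<Longrightarrow> (f has_derivative blinfun_apply (f' x)) (at x)"
    and cont: "\<And>x. x \<in> S \<Longrightarrow> isCont f' x"
    using twice_cont_diff_on_blinfun [OF assms] by blast
  have "grad f x = (\<chi> i. blinfun_apply (f' x) (axis i 1))" if "x \<in> S" for x
  proof (rule grad_eqI)
    have "h \<bullet> (\<chi> i. blinfun_apply (f' x) (axis i 1)) = blinfun_apply (f' x) h" for h
    proof -
      have "h = (\<Sum>i\<in>UNIV. h $ i *\<^sub>R axis i 1)"
        using basis_expansion [of h] by (simp add: scalar_mult_eq_scaleR)
      then have "blinfun_apply (f' x) h = blinfun_apply (f' x) (\<Sum>i\<in>UNIV. h $ i *\<^sub>R axis i 1)"
        by (rule arg_cong)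
      also have "\<dots> = (\<Sum>i\<in>UNIV. h $ i * blinfun_apply (f' x) (axis i 1))"
        by (simp add: blinfun.sum_right blinfun.scaleR_right)
      finally have "blinfun_apply (f' x) h = (\<Sum>i\<in>UNIV. h $ i * blinfun_apply (f' x) (axis i 1))" .
      then show ?thesis
        by (simp add: inner_vec_def)
    qed
    then show "GDERIV f x :> (\<chi> i. blinfun_apply (f' x) (axis i 1))"
      using f' [OF that] by (simp add: gderiv_def)
  qed
  moreover have "continuous_on S (\<lambda>x. \<chi> i. blinfun_apply (f' x) (axis i 1))"
    using cont
    by (intro continuous_on_vec_lambda continuous_intros)
       (auto intro: continuous_at_imp_continuous_on)
  ultimately show ?thesis
    by simp
qed

section \<open>Runs with convergent subproblem solutions\<close>

lemma closed_nonneg_vec: "closed {x::real^'n. 0 \<le> x}"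
  unfolding less_eq_vec_def
  by (intro closed_Collect_all closed_Collect_le continuous_on_const continuous_on_component continuous_on_id)

locale convergent_LCL_run =
  fixes f :: "real^'n \<Rightarrow> real"
    and c :: "real^'n \<Rightarrow> real^'m"
    and \<Omega> :: "(real^'n) set"
    and P :: lcl_params
    and x z xs zs :: "nat \<Rightarrow> real^'n"
    and y dy :: "nat \<Rightarrow> real^'m"
    and \<rho> \<sigma> \<omega> \<eta> :: "nat \<Rightarrow> real"
    and xstar :: "real^'n"
  assumes open_domain: "open \<Omega>" and nonneg_subset: "{x. 0 \<le> x} \<subseteq> \<Omega>"
    and f_smooth: "twice_cont_diff_on \<Omega> f" and c_smooth: "twice_cont_diff_on \<Omega> c"
    and omega_star: "omega_star P = 0" and eta_star: "eta_star P = 0"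
    and run: "stabilized_LCL_run f c \<Omega> P x y z \<rho> \<sigma> \<omega> \<eta> xs dy zs"
    and xs_lim: "xs \<longlonglongrightarrow> xstar"
    and rank: "full_row_rank (restrict_cols (inactive xstar) (Jac c xstar))"
begin

definition success :: "nat \<Rightarrow> bool" where
  "success k \<longleftrightarrow> norm (c (xs k)) \<le> max 0 (\<eta> k)"

text \<open>
  The multiplier estimate of a successful iteration, formed at every iteration so that its
  convergence can be studied before it is known which iterations succeed.
\<close>
definition trial_y :: "nat \<Rightarrow> real^'m" where
  "trial_y k = y k + dy k - \<rho> k *\<^sub>R c (xs k)"

abbreviation limit_y :: "real^'m" where
  "limit_y \<equiv> ls_multiplier f c (inactive xstar) xstar"

lemma params:
  "0 < sigma_low P" "sigma_low P < sigma_high P" "1 < tau_rho P" "1 < tau_sigma P"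
  "1 < rho_init P" "1 < sigma_init P" "0 < eta_init P" "alpha P < 1" "0 < beta P"
  using run eta_star by (auto simp: stabilized_LCL_run_def valid_params_def)

lemma initial: "\<rho> 0 = rho_init P" "\<sigma> 0 = sigma_init P" and omega_lim: "\<omega> \<longlonglongrightarrow> 0"
  using run omega_star by (auto simp: stabilized_LCL_run_def)

lemma subproblem: "elastic_solution f c (\<omega> k) (\<rho> k) (\<sigma> k) (x k) (y k) (xs k) (dy k) (zs k)"
  using run by (simp add: stabilized_LCL_run_def closest_elastic_solution_def)

lemma updates:
  "if success k
   then x (Suc k) = xs k \<and> y (Suc k) = trial_y k \<and> z (Suc k) = zs k \<and> \<rho> (Suc k) = \<rho> k \<and>
        \<sigma> (Suc k) = max (sigma_low P) (min (infnorm (dy k)) (sigma_high P)) \<and>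
        \<eta> (Suc k) = \<eta> k / \<rho> (Suc k) powr beta P
   else x (Suc k) = x k \<and> y (Suc k) = y k \<and> z (Suc k) = z k \<and> \<rho> (Suc k) = tau_rho P * \<rho> k \<and>
        \<sigma> (Suc k) = \<sigma> k / tau_sigma P \<and> \<eta> (Suc k) = eta_init P / \<rho> (Suc k) powr alpha P"
  using run unfolding stabilized_LCL_run_def success_def trial_y_def eta_star by presburger

lemma iterate_Suc:
  "x (Suc k) = (if success k then xs k else x k)"
  "y (Suc k) = (if success k then trial_y k else y k)"
  "z (Suc k) = (if success k then zs k else z k)"
  and rho_Suc: "\<rho> (Suc k) = (if success k then \<rho> k else tau_rho P * \<rho> k)"
  using updates [of k] by presburger+

lemma rho_gt_1: "1 < \<rho> k"
  by (induction k) (use params(3,5) initial(1) rho_Suc less_1_mult in auto)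

lemma xs_nonneg: "0 \<le> xs k"
  using subproblem [of k] by (auto simp: elastic_solution_def)

lemma xstar_nonneg: "0 \<le> xstar"
  using closed_sequentially [OF closed_nonneg_vec _ xs_lim] xs_nonneg by simp

lemma xs_in_domain: "xs k \<in> \<Omega>" and xstar_in_domain: "xstar \<in> \<Omega>"
  using nonneg_subset xs_nonneg xstar_nonneg by auto

lemma tendsto_at_xstar:
  assumes "continuous_on \<Omega> F" and "s \<longlonglongrightarrow> xstar"
  shows "(\<lambda>k. F (s k)) \<longlonglongrightarrow> F xstar"
proof -
  have "isCont F xstar"
    using assms(1) open_domain xstar_in_domain by (simp add: continuous_on_eq_continuous_at)
  then show ?thesis
    using assms(2) by (rule isCont_tendsto_compose)
qed

lemma Jac_lim: "s \<longlonglongrightarrow> xstar \<Longrightarrow> (\<lambda>k. Jac c (s k)) \<longlonglongrightarrow> Jac c xstar"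
  by (rule tendsto_at_xstar [OF continuous_on_Jac [OF c_smooth]])

lemma grad_lim: "s \<longlonglongrightarrow> xstar \<Longrightarrow> (\<lambda>k. grad f (s k)) \<longlonglongrightarrow> grad f xstar"
  by (rule tendsto_at_xstar [OF continuous_on_grad [OF f_smooth]])

lemma c_lim: "(\<lambda>k. c (xs k)) \<longlonglongrightarrow> c xstar"
proof (rule isCont_tendsto_compose [OF _ xs_lim])
  show "isCont c xstar"
    using twice_cont_diff_on_imp_differentiable [OF c_smooth xstar_in_domain]
    by (rule differentiable_imp_continuous_within)
qed

lemma grad_aug_lagrangian_at:
  assumes "a \<in> \<Omega>"
  shows "grad_aug_lagrangian f c a w r = grad f a - (w - r *\<^sub>R c a) v* Jac c a"
  using grad_aug_lagrangian_eq [of f a c w r] assms f_smooth c_smooth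
  by (simp add: twice_cont_diff_on_imp_differentiable)

subsection \<open>Convergence of the trial multipliers\<close>

text \<open>
  The subproblem uses the Jacobian at \<open>x k\<close> for \<open>dy k\<close> but the one at \<open>xs k\<close> for the augmented
  Lagrangian. Moving \<open>dy k\<close> into the trial multiplier costs exactly the last term.
\<close>
lemma zs_eq:
  "zs k = grad f (xs k) - trial_y k v* Jac c (xs k) + dy k v* (Jac c (xs k) - Jac c (x k))"
proof -
  interpret vm: bounded_bilinear "\<lambda>(u::real^'m) (A::real^'n^'m). u v* A"
    by (rule bounded_bilinear_vector_matrix_mult)
  have "zs k = grad f (xs k) - (y k - \<rho> k *\<^sub>R c (xs k)) v* Jac c (xs k) - dy k v* Jac c (x k)"
    using subproblem [of k]
    by (simp add: elastic_solution_def grad_aug_lagrangian_at [OF xs_in_domain])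
  also have "y k - \<rho> k *\<^sub>R c (xs k) = trial_y k - dy k"
    by (simp add: trial_y_def)
  finally show ?thesis
    by (simp add: vm.diff_left vm.diff_right)
qed

lemma complementarity_bound: "\<bar>min (xs k $ j) (zs k $ j)\<bar> \<le> \<omega> k"
  using subproblem [of k] component_le_infnorm_cart [of "vmin (xs k) (zs k)" j]
  by (simp add: elastic_solution_def vmin_def)

text \<open>
  On an inactive index the component of \<open>xs k\<close> eventually exceeds the tolerance, so the
  small minimum is attained by the component of \<open>zs k\<close>.
\<close>
lemma zs_inactive_lim:
  assumes "j \<in> inactive xstar"
  shows "(\<lambda>k. zs k $ j) \<longlonglongrightarrow> 0"
proof (rule Lim_null_comparison [OF _ omega_lim])
  have "(\<lambda>k. xs k $ j - \<omega> k) \<longlonglongrightarrow> xstar $ j - 0"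
    by (intro tendsto_diff tendsto_vec_nth xs_lim omega_lim)
  then have "\<forall>\<^sub>F k in sequentially. 0 < xs k $ j - \<omega> k"
    using assms by (intro order_tendstoD) (simp_all add: inactive_def)
  then show "\<forall>\<^sub>F k in sequentially. norm (zs k $ j) \<le> \<omega> k"
  proof eventually_elim
    case (elim k)
    then show ?case
      using complementarity_bound [of k j] by (auto simp: min_def split: if_splits)
  qed
qed

lemma trial_y_lim:
  assumes "(\<lambda>k. dy k v* (Jac c (xs k) - Jac c (x k))) \<longlonglongrightarrow> 0"
  shows "trial_y \<longlonglongrightarrow> limit_y"
proof -
  let ?I = "inactive xstar"
  have "(\<lambda>k. restrict_vec ?I (trial_y k v* Jac c (xs k))) \<longlonglongrightarrow> restrict_vec ?I (grad f xstar)"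
  proof (rule vec_tendstoI)
    fix j
    show "(\<lambda>k. restrict_vec ?I (trial_y k v* Jac c (xs k)) $ j) \<longlonglongrightarrow> restrict_vec ?I (grad f xstar) $ j"
    proof (cases "j \<in> ?I")
      case True
      have "(trial_y k v* Jac c (xs k)) $ j
          = grad f (xs k) $ j + (dy k v* (Jac c (xs k) - Jac c (x k))) $ j - zs k $ j" for k
        by (simp add: zs_eq [of k])
      moreover have "(\<lambda>k. grad f (xs k) $ j + (dy k v* (Jac c (xs k) - Jac c (x k))) $ j - zs k $ j)
          \<longlonglongrightarrow> grad f xstar $ j + 0 $ j - 0"
        using True
        by (intro tendsto_diff tendsto_add tendsto_vec_nth grad_lim xs_lim assms zs_inactive_lim)
      ultimately show ?thesis
        using True by (simp add: restrict_vec_def)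
    qed (simp add: restrict_vec_def)
  qed
  then have lim: "(\<lambda>k. trial_y k v* restrict_cols ?I (Jac c (xs k))) \<longlonglongrightarrow> restrict_vec ?I (grad f xstar)"
    by (simp add: vector_matrix_mult_restrict_cols)
  have "(\<lambda>k. restrict_cols ?I (Jac c (xs k))) \<longlonglongrightarrow> restrict_cols ?I (Jac c xstar)"
    unfolding restrict_cols_def
    by (intro tendsto_vec_lambda) (auto intro!: tendsto_vec_nth Jac_lim xs_lim)
  from tendsto_solution_full_row_rank [OF rank this lim]
  obtain y' where y': "y' v* restrict_cols ?I (Jac c xstar) = restrict_vec ?I (grad f xstar)"
    and "trial_y \<longlonglongrightarrow> y'" .
  then show ?thesis
    using ls_multiplier_eqI [OF rank y'] by simp
qed

subsection \<open>Boundedness of the elastic weights and the scaled constraint violation\<close>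

lemma sigma_bounds: "0 < \<sigma> k \<and> \<sigma> k \<le> max (sigma_init P) (sigma_high P)"
proof (induction k)
  case 0
  then show ?case using params initial by simp
next
  case (Suc k)
  have "\<sigma> k / tau_sigma P \<le> \<sigma> k"
    using Suc params(4) by (simp add: divide_le_eq)
  then show ?case
    using updates [of k] params Suc by (auto split: if_splits)
qed

lemma infnorm_dy: "infnorm (dy k) \<le> \<sigma> k + \<omega> k"
  using subproblem [of k] by (simp add: elastic_solution_def)

lemma Bfun_dy: "Bfun dy sequentially"
proof -
  obtain W where W: "\<And>k. \<bar>\<omega> k\<bar> \<le> W"
    using convergent_imp_Bseq [OF convergentI [OF omega_lim]] by (metis BseqE real_norm_def)
  have "norm (dy k) \<le> sqrt (real DIM(real^'m)) * (max (sigma_init P) (sigma_high P) + W)" for k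
  proof -
    have "norm (dy k) \<le> sqrt (real DIM(real^'m)) * infnorm (dy k)"
      by (rule norm_le_infnorm)
    also have "\<dots> \<le> sqrt (real DIM(real^'m)) * (max (sigma_init P) (sigma_high P) + W)"
      using infnorm_dy [of k] sigma_bounds [of k] W [of k] by (intro mult_left_mono) auto
    finally show ?thesis .
  qed
  then show ?thesis
    by (intro BfunI always_eventually allI)
qed

lemma rho_at_top: "infinite {k. \<not> success k} \<Longrightarrow> filterlim \<rho> at_top sequentially"
  using params initial rho_Suc
  by (intro filterlim_at_top_if_scaled_infinitely_often [where A = success and \<tau> = "tau_rho P"]) auto

text \<open>
  By definition of the trial multiplier, \<open>\<rho> k *\<^sub>R c (xs k)\<close> is the difference of the bounded
  sequences \<open>y k + dy k\<close> and \<open>trial_y k\<close>.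
\<close>
lemma scaled_violation_bounded:
  assumes "trial_y \<longlonglongrightarrow> limit_y" and "convergent y"
  obtains M where "\<And>k. \<rho> k * norm (c (xs k)) \<le> M"
proof -
  obtain M1 where M1: "\<And>k. norm (trial_y k) \<le> M1"
    using convergent_imp_Bseq [OF convergentI [OF assms(1)]] by (meson BseqE)
  obtain M2 where M2: "\<And>k. norm (y k) \<le> M2"
    using convergent_imp_Bseq [OF assms(2)] by (meson BseqE)
  obtain M3 where M3: "\<And>k. norm (dy k) \<le> M3"
    using Bfun_dy by (meson BseqE)
  have "\<rho> k * norm (c (xs k)) \<le> M2 + M3 + M1" for k
  proof -
    have "\<rho> k * norm (c (xs k)) = norm (y k + dy k - trial_y k)"
      using rho_gt_1 [of k] by (simp add: trial_y_def)
    also have "\<dots> \<le> norm (y k) + norm (dy k) + norm (trial_y k)"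
      using norm_triangle_ineq4 [of "y k + dy k" "trial_y k"] norm_triangle_ineq [of "y k" "dy k"]
      by linarith
    finally show ?thesis
      using M1 [of k] M2 [of k] M3 [of k] by linarith
  qed
  then show ?thesis
    by (rule that)
qed

subsection \<open>Infinitely many iterations succeed\<close>

text \<open>
  Otherwise \<open>x\<close> and \<open>y\<close> freeze while \<open>dy\<close> tends to 0, so the constraint violation is
  \<open>O(1 / \<rho>)\<close>, which passes the test against \<open>\<eta> = eta_init / \<rho> powr alpha\<close> once
  \<open>\<rho>\<close> is large.
\<close>
lemma infinitely_many_successes: "infinite {k. success k}"
proof
  assume fin: "finite {k. success k}"
  then obtain N where N: "\<And>k. k \<ge> N \<Longrightarrow> \<not> success k"
    by (metis finite_nat_set_iff_bounded mem_Collect_eq not_less)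
  have const: "x k = x N \<and> y k = y N" if "k \<ge> N" for k
    using that by (induction k rule: dec_induct) (auto simp: iterate_Suc N)
  have ev: "\<forall>\<^sub>F k in sequentially. x k = x N" "\<forall>\<^sub>F k in sequentially. y k = y N"
    using const unfolding eventually_sequentially by blast+
  have "\<sigma> (Suc k) = 1 / tau_sigma P * \<sigma> k" if "k \<ge> N" for k
    using updates [of k] N [OF that] by simp
  then have "\<sigma> \<longlonglongrightarrow> 0"
    using params(4) by (intro tendsto_const_mult_power_shift [where q = "1 / tau_sigma P"]) auto
  then have "(\<lambda>k. \<sigma> k + \<omega> k) \<longlonglongrightarrow> 0"
    using tendsto_add [OF _ omega_lim] by fastforce
  then have "dy \<longlonglongrightarrow> 0"
    using infnorm_dy by (rule tendsto_zero_if_infnorm_le)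
  moreover have "(\<lambda>k. Jac c (xs k) - Jac c (x k)) \<longlonglongrightarrow> Jac c xstar - Jac c (x N)"
    using ev(1) by (intro tendsto_diff Jac_lim xs_lim tendsto_eventually) (auto elim: eventually_mono)
  ultimately have "(\<lambda>k. dy k v* (Jac c (xs k) - Jac c (x k))) \<longlonglongrightarrow> 0 v* (Jac c xstar - Jac c (x N))"
    by (rule bounded_bilinear.tendsto [OF bounded_bilinear_vector_matrix_mult])
  then have "trial_y \<longlonglongrightarrow> limit_y"
    by (intro trial_y_lim) simp
  moreover have "convergent y"
    using tendsto_eventually [OF ev(2)] by (rule convergentI)
  ultimately obtain M where M: "\<And>k. \<rho> k * norm (c (xs k)) \<le> M"
    using scaled_violation_bounded by blast
  have "infinite {k. \<not> success k}"
    using fin finite_Collect_not infinite_UNIV_nat by blast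
  then have "(\<lambda>k. M * \<rho> k powr (alpha P - 1)) \<longlonglongrightarrow> 0"
    using params(8) rho_at_top by (intro tendsto_mult_right_zero tendsto_neg_powr) auto
  then have "\<forall>\<^sub>F k in sequentially. M * \<rho> k powr (alpha P - 1) < eta_init P"
    using params(7) by (rule order_tendstoD)
  then obtain N' where N': "\<And>k. k \<ge> N' \<Longrightarrow> M * \<rho> k powr (alpha P - 1) < eta_init P"
    by (auto simp: eventually_sequentially)
  \<comment> \<open>The test is examined at \<open>Suc k\<close>: the formula for \<open>\<eta>\<close> holds there because \<open>k\<close> itself failed.\<close>
  define k where "k = max N N'"
  have le: "N \<le> Suc k" "N' \<le> Suc k"
    by (simp_all add: k_def)
  have pos: "0 < \<rho> (Suc k)"
    using rho_gt_1 [of "Suc k"] by simp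
  have "eta_init P / \<rho> (Suc k) powr alpha P = \<eta> (Suc k)"
    using updates [of k] N [of k] by (simp add: k_def)
  also have "\<dots> \<le> norm (c (xs (Suc k)))"
    using N [OF le(1)] by (simp add: success_def)
  also have "\<dots> \<le> M / \<rho> (Suc k)"
    using M [of "Suc k"] pos by (simp add: field_simps)
  finally have "eta_init P \<le> M * \<rho> (Suc k) powr (alpha P - 1)"
    using pos by (simp add: powr_diff field_simps)
  then show False
    using N' [OF le(2)] by simp
qed

subsection \<open>Limits of the iterates\<close>

lemma x_lim: "x \<longlonglongrightarrow> xstar"
  using xs_lim infinitely_many_successes iterate_Suc(1) by (rule tendsto_last_accepted)

lemma linearization_error_lim: "(\<lambda>k. dy k v* (Jac c (xs k) - Jac c (x k))) \<longlonglongrightarrow> 0"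
proof -
  have "(\<lambda>k. Jac c (xs k) - Jac c (x k)) \<longlonglongrightarrow> Jac c xstar - Jac c xstar"
    by (intro tendsto_diff Jac_lim xs_lim x_lim)
  then have "Zfun (\<lambda>k. dy k v* (Jac c (xs k) - Jac c (x k))) sequentially"
    by (intro bounded_bilinear.Bfun_prod_Zfun [OF bounded_bilinear_vector_matrix_mult Bfun_dy])
       (simp add: tendsto_Zfun_iff)
  then show ?thesis
    by (simp add: tendsto_Zfun_iff)
qed

lemma y_lim: "y \<longlonglongrightarrow> limit_y"
  using trial_y_lim [OF linearization_error_lim] infinitely_many_successes iterate_Suc(2)
  by (rule tendsto_last_accepted)

lemma zs_lim: "zs \<longlonglongrightarrow> grad f xstar - limit_y v* Jac c xstar"
proof -
  have "(\<lambda>k. grad f (xs k) - trial_y k v* Jac c (xs k) + dy k v* (Jac c (xs k) - Jac c (x k)))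
      \<longlonglongrightarrow> grad f xstar - limit_y v* Jac c xstar + 0"
    by (intro tendsto_add tendsto_diff grad_lim xs_lim linearization_error_lim Jac_lim
        trial_y_lim bounded_bilinear.tendsto [OF bounded_bilinear_vector_matrix_mult])
  then show ?thesis
    unfolding zs_eq [symmetric] by simp
qed

lemma z_lim: "z \<longlonglongrightarrow> grad f xstar - limit_y v* Jac c xstar"
  using zs_lim infinitely_many_successes iterate_Suc(3) by (rule tendsto_last_accepted)

subsection \<open>The limit is a KKT point\<close>

lemma c_xstar: "c xstar = 0"
proof -
  have "(\<lambda>k. c (xs k)) \<longlonglongrightarrow> 0"
  proof (cases "finite {k. \<not> success k}")
    case True
    \<comment> \<open>Eventually every iteration succeeds, \<open>\<rho>\<close> is a constant above 1, and \<open>\<eta>\<close> decays geometrically.\<close>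
    then obtain N where N: "\<And>k. k \<ge> N \<Longrightarrow> success k"
      by (metis finite_nat_set_iff_bounded mem_Collect_eq not_less)
    have rho: "\<rho> k = \<rho> N" if "k \<ge> N" for k
      using that by (induction k rule: dec_induct) (auto simp: rho_Suc N)
    have "\<eta> (Suc k) = 1 / \<rho> N powr beta P * \<eta> k" if "k \<ge> N" for k
      using updates [of k] N [OF that] rho [OF that] by simp
    moreover have "1 < \<rho> N powr beta P"
      using rho_gt_1 params(9) by (rule gr_one_powr)
    ultimately have "\<eta> \<longlonglongrightarrow> 0"
      by (intro tendsto_const_mult_power_shift [where q = "1 / \<rho> N powr beta P"])
        (auto simp: divide_less_eq)
    then have "(\<lambda>k. max 0 (\<eta> k)) \<longlonglongrightarrow> 0"
      using tendsto_max [OF tendsto_const [of 0] \<open>\<eta> \<longlonglongrightarrow> 0\<close>] by simp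
    moreover have "\<forall>\<^sub>F k in sequentially. norm (c (xs k)) \<le> max 0 (\<eta> k)"
      using N by (auto simp: success_def eventually_sequentially)
    ultimately show ?thesis
      by (rule Lim_null_comparison [rotated])
  next
    case False
    obtain M where M: "\<And>k. \<rho> k * norm (c (xs k)) \<le> M"
      using scaled_violation_bounded [OF trial_y_lim [OF linearization_error_lim] convergentI [OF y_lim]]
      by blast
    show ?thesis
    proof (rule Lim_null_comparison)
      show "\<forall>\<^sub>F k in sequentially. norm (c (xs k)) \<le> M / \<rho> k"
      proof (intro always_eventually allI)
        fix k
        show "norm (c (xs k)) \<le> M / \<rho> k"
          using M [of k] rho_gt_1 [of k] by (simp add: field_simps)
      qed
      show "(\<lambda>k. M / \<rho> k) \<longlonglongrightarrow> 0"
        using rho_at_top [OF False] by (rule real_tendsto_divide_at_top [OF tendsto_const])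
    qed
  qed
  with c_lim show ?thesis
    by (rule LIMSEQ_unique)
qed

lemma vmin_limit: "vmin xstar (grad f xstar - limit_y v* Jac c xstar) = 0"
proof -
  have "min (xstar $ j) ((grad f xstar - limit_y v* Jac c xstar) $ j) = 0" for j
  proof (rule LIMSEQ_unique)
    show "(\<lambda>k. min (xs k $ j) (zs k $ j))
        \<longlonglongrightarrow> min (xstar $ j) ((grad f xstar - limit_y v* Jac c xstar) $ j)"
      by (intro tendsto_min tendsto_vec_nth xs_lim zs_lim)
    show "(\<lambda>k. min (xs k $ j) (zs k $ j)) \<longlonglongrightarrow> 0"
      using complementarity_bound [of _ j]
      by (intro Lim_null_comparison [OF always_eventually omega_lim]) simp
  qed
  then show ?thesis
    by (simp add: vmin_def vec_eq_iff)
qed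

lemma KKT_limit: "KKT_point f c xstar limit_y (grad f xstar - limit_y v* Jac c xstar)"
  by (simp add: KKT_point_def c_xstar vmin_limit grad_aug_lagrangian_at [OF xstar_in_domain])

end


section \<open>Convergence to a KKT point\<close>

theorem corollary3p7:
  fixes f :: "real^'n \<Rightarrow> real"
    and c :: "real^'n \<Rightarrow> real^'m"
    and \<Omega> B :: "(real^'n) set"
    and P :: lcl_params
    and x z xs zs :: "nat \<Rightarrow> real^'n"
    and y dy :: "nat \<Rightarrow> real^'m"
    and \<rho> \<sigma> \<omega> \<eta> :: "nat \<Rightarrow> real"
    and xstar zstar :: "real^'n"
    and ystar :: "real^'m"
  assumes "\<exists>x. feasible c x"
    and "\<exists>x y z. KKT_point f c x y z"
    and "open \<Omega>" and "{x. 0 \<le> x} \<subseteq> \<Omega>"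
    and "twice_cont_diff_on \<Omega> f" and "twice_cont_diff_on \<Omega> c"
    and "omega_star P = 0" and "eta_star P = 0"
    and "stabilized_LCL_run f c \<Omega> P x y z \<rho> \<sigma> \<omega> \<eta> xs dy zs"
    and "closed B" and "bounded B" and "\<forall>k. xs k \<in> B"
    and "limit_points xs = {xstar}"
    and "full_row_rank (restrict_cols (inactive xstar) (Jac c xstar))"
    and "ystar = ls_multiplier f c (inactive xstar) xstar"
    and "zstar = grad_aug_lagrangian f c xstar ystar 0"
  shows "(\<lambda>k. (x k, y k, z k)) \<longlonglongrightarrow> (xstar, ystar, zstar) \<and> KKT_point f c xstar ystar zstar"
proof -
  have "range xs \<subseteq> B"
    using assms(12) by blast
  then have "bounded (range xs)"
    using assms(11) bounded_subset by blast
  then have "xs \<longlonglongrightarrow> xstar"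
    using assms(13) by (rule bounded_limit_points_singleton_imp_tendsto)
  then interpret convergent_LCL_run f c \<Omega> P x z xs zs y dy \<rho> \<sigma> \<omega> \<eta> xstar
    using assms by unfold_locales
  have y: "ystar = limit_y"
    using assms(15) .
  have z: "zstar = grad f xstar - limit_y v* Jac c xstar"
    unfolding assms(16) y grad_aug_lagrangian_at [OF xstar_in_domain] by simp
  show ?thesis
    unfolding y z by (intro conjI tendsto_Pair x_lim y_lim z_lim KKT_limit)
qed

end
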